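(* Consider the average-cost Markov decision process described in the context, with Bellman equation, for each state $s$, $$\theta+V(s)=\min_{\delta\in\{0,1,2\}}\Big\{s+\lambda_1\mathbf 1_{\delta=1}+\lambda_2\mathbf 1_{\delta=2}+\sum_{s'\in\{0,1,2,\dots\}}\Pr(s\to s'\mid\delta)\,V(s')\Big\},$$ where $\theta$ is the optimal value and $V(s)$ is the differential cost-to-go function when the state is $s$. The optimal solution to this problem is an increasing multi-threshold policy: there exist $n_1$ and $n_2$ with $n_1\le n_2$ such that the optimal action is $\delta=0$ if $s<n_1$, the optimal action is $\delta=1$ if $n_1\le s<n_2$, and the optimal action is $\delta=2$ if $s\ge n_2$.
   Context: Source: a binary Markov process with a stable mode $0$ and an unstable mode $1$. The probability of transitioning from the stable to the unstable mode is $1-r_0$, and from the unstable to the stable mode is $1-r_1$, where $r_0+r_1\ge 1$. Communication and control: at each time $t$ a sensor observes the source and chooses an action $\delta(t)\in\{0,1,2\}$: $0$ = stay idle, $1$ = transmit compressed information about the source state, $2$ = transmit uncompressed information. A transmitted packet is successfully decoded by the controller with probability $\rho$. On receiving a compressed (respectively uncompressed) message, the controller succeeds in stabilizing the source with probability $p$ (respectively $q$), where $q>p$. Transmitting a compressed (respectively uncompressed) message requires energy $\lambda_1$ (respectively $\lambda_2$), where $\lambda_2>\lambda_1$. Markov decision process: the state $s(t)\in\{0,1,2,\dots\}$ is the Age of System Instability (AoSI), which increases by one as long as the source moves to or remains in the unstable mode and resets to $0$ once the source is stable. From state $s$ under action $\delta$, the next state is $s+1$ with probability $\Pr(s\to s+1\mid\delta)$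 and $0$ with probability $1-\Pr(s\to s+1\mid\delta)$, where, writing $r(s)=1-r_0$ if $s=0$ and $r(s)=r_1$ if $s>0$, $$\Pr(s\to s+1\mid 0)=r(s),$$ $$\Pr(s\to s+1\mid 1)=(1-\rho)r(s)+\rho(1-p)r(s),$$ $$\Pr(s\to s+1\mid 2)=(1-\rho)r(s)+\rho(1-q)r(s).$$ The stage cost is $C(t)=s(t)+\lambda_1\mathbf 1_{\delta(t)=1}+\lambda_2\mathbf 1_{\delta(t)=2}$. The objective is to minimize, over all causal scheduling policies $\pi=(\delta^\pi(0),\delta^\pi(1),\dots)$, $$\liminf_{T\to\infty}\frac1T\,\mathbb E^{\pi}\Big[\sum_{t=0}^{T-1}C^{\pi}(t)\,\Big|\,s(0)\Big],$$ where $C^\pi(t)$ is the stage cost at time $t$ under $\pi$. The optimal scheduling policy is obtained by solving the Bellman equation for each state $s$. *)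

theory Defs
  imports "HOL-Probability.Probability"
begin

text \<open>
  Parameters: \<open>r0\<close>, \<open>r1\<close> are the probabilities of remaining in the stable and in the unstable
  mode, \<open>rho\<close> the decoding probability, \<open>p1\<close> and \<open>p2\<close> (the \<open>p\<close> and \<open>q\<close> of the model) the
  stabilization probabilities for a compressed and an uncompressed message, and \<open>energy1\<close>,
  \<open>energy2\<close> (\<open>\<lambda>\<^sub>1\<close> and \<open>\<lambda>\<^sub>2\<close>) the corresponding energies.
\<close>

record aosi_system =
  r0 :: real
  r1 :: real
  rho :: real
  p1 :: real
  p2 :: real
  energy1 :: real
  energy2 :: real

datatype action = Idle | Compressed | Uncompressed

definition drift :: "aosi_system \<Rightarrow> nat \<Rightarrow> real" where
  "drift M s = (if s = 0 then 1 - r0 M else r1 M)"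

fun up_prob :: "aosi_system \<Rightarrow> nat \<Rightarrow> action \<Rightarrow> real" where
  "up_prob M s Idle = drift M s"
| "up_prob M s Compressed = (1 - rho M) * drift M s + rho M * (1 - p1 M) * drift M s"
| "up_prob M s Uncompressed = (1 - rho M) * drift M s + rho M * (1 - p2 M) * drift M s"

definition step :: "aosi_system \<Rightarrow> nat \<Rightarrow> action \<Rightarrow> nat pmf" where
  "step M s \<delta> = map_pmf (\<lambda>up. if up then Suc s else 0) (bernoulli_pmf (up_prob M s \<delta>))"

fun cost :: "aosi_system \<Rightarrow> nat \<Rightarrow> action \<Rightarrow> real" where
  "cost M s Idle = real s"
| "cost M s Compressed = real s + energy1 M"
| "cost M s Uncompressed = real s + energy2 M"

text \<open>
  A causal policy may randomize and may use the whole past: it maps the list of earlier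
  state-action pairs (most recent first) and the current state to a distribution over actions.
  \<open>run M \<pi> s0 t\<close> is the joint law of that list and of the state at time \<open>t\<close>. Its support is
  finite, so the expectations below are those of integrable functions.
\<close>

type_synonym policy = "(nat \<times> action) list \<Rightarrow> nat \<Rightarrow> action pmf"

primrec run :: "aosi_system \<Rightarrow> policy \<Rightarrow> nat \<Rightarrow> nat \<Rightarrow> ((nat \<times> action) list \<times> nat) pmf" where
  "run M \<pi> s0 0 = return_pmf ([], s0)"
| "run M \<pi> s0 (Suc t) =
     bind_pmf (run M \<pi> s0 t) (\<lambda>(h, s).
       bind_pmf (\<pi> h s) (\<lambda>\<delta>.
         map_pmf (\<lambda>s'. ((s, \<delta>) # h, s')) (step M s \<delta>)))"

definition total_cost :: "aosi_system \<Rightarrow> policy \<Rightarrow> nat \<Rightarrow> nat \<Rightarrow> real" where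
  "total_cost M \<pi> s0 T =
     measure_pmf.expectation (run M \<pi> s0 T) (\<lambda>(h, _). \<Sum>(s, \<delta>)\<leftarrow>h. cost M s \<delta>)"

definition average_cost :: "aosi_system \<Rightarrow> policy \<Rightarrow> nat \<Rightarrow> ereal" where
  "average_cost M \<pi> s0 = liminf (\<lambda>T. ereal (total_cost M \<pi> s0 T / real T))"

definition optimal_value :: "aosi_system \<Rightarrow> nat \<Rightarrow> ereal" where
  "optimal_value M s0 = (INF \<pi>. average_cost M \<pi> s0)"

definition optimal_policy :: "aosi_system \<Rightarrow> policy \<Rightarrow> bool" where
  "optimal_policy M \<pi> \<longleftrightarrow> (\<forall>s0. average_cost M \<pi> s0 = optimal_value M s0)"

definition stationary :: "(nat \<Rightarrow> action) \<Rightarrow> policy" where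
  "stationary f = (\<lambda>h s. return_pmf (f s))"

definition action_value :: "aosi_system \<Rightarrow> (nat \<Rightarrow> real) \<Rightarrow> nat \<Rightarrow> action \<Rightarrow> real" where
  "action_value M V s \<delta> = cost M s \<delta> + measure_pmf.expectation (step M s \<delta>) V"

text \<open>
  The equation alone does not determine \<open>V\<close>: for \<open>r0 M = 1\<close> the value \<open>V 1\<close> is unconstrained
  by the equation at \<open>0\<close>, and for \<open>rho M * p2 M = 1\<close> action \<open>Uncompressed\<close> hides \<open>V (Suc s)\<close>.
  The spurious solutions that are not differential costs-to-go because they lie too low tend to
  minus infinity, whereas a differential cost-to-go is bounded below because the stage cost
  exceeds \<open>\<theta>\<close> in all but finitely many states.
\<close>

definition bellman_solution :: "aosi_system \<Rightarrow> real \<Rightarrow> (nat \<Rightarrow> real) \<Rightarrow> bool" where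
  "bellman_solution M \<theta> V \<longleftrightarrow>
     (\<forall>s0. optimal_value M s0 = ereal \<theta>) \<and>
     bdd_below (range V) \<and>
     (\<forall>s. \<theta> + V s = Min (action_value M V s ` {Idle, Compressed, Uncompressed}))"

text \<open>
  The thresholds may be infinite, since a system in which transmitting never changes the
  dynamics (\<open>rho M = 0\<close> or \<open>r1 M = 0\<close>) never benefits from transmitting.
\<close>

definition threshold :: "enat \<Rightarrow> enat \<Rightarrow> nat \<Rightarrow> action" where
  "threshold n1 n2 s =
     (if enat s < n1 then Idle else if enat s < n2 then Compressed else Uncompressed)"

end

theory Submission
  imports Defs
begin

text \<open>
  With \<open>x = drift M s * (V (s + 1) - V 0)\<close>, the action \<open>\<delta>\<close> contributes the affine function
  \<open>energy \<delta> + (1 - efficacy \<delta>) * x\<close> to the Bellman equation. Energy and efficacy increase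
  together, so the optimal action increases with \<open>x\<close> for \<open>x \<ge> 0\<close>, and is to idle for \<open>x \<le> 0\<close>.
  A solution that decreased somewhere above \<open>0\<close> would decrease ever faster from there on and
  could not be bounded below; hence \<open>x\<close> increases with \<open>s\<close>, and thresholds result.

  For existence, fix \<open>\<theta>\<close> and start from the linear solution for the policy that always uses the
  action optimal far out; finitely many backward Bellman steps turn it into a solution of all
  equations at \<open>s > 0\<close>. It depends continuously on \<open>\<theta>\<close>, and the intermediate value theorem
  provides the \<open>\<theta>\<close> that satisfies the equation at \<open>0\<close>. Optimality of \<open>\<theta>\<close> uses that the state
  climbs by at most one per step, so that a large expected state at time \<open>T\<close> forces a much
  larger total cost.
\<close>

subsection \<open>Expectations along a run\<close>

lemma expectation_bind_pmf_finite:
  fixes h :: "'b \<Rightarrow> real"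
  assumes "finite (set_pmf p)" "\<And>x. x \<in> set_pmf p \<Longrightarrow> finite (set_pmf (f x))"
  shows "measure_pmf.expectation (bind_pmf p f) h
       = measure_pmf.expectation p (\<lambda>x. measure_pmf.expectation (f x) h)"
  using pmf_expectation_bind[OF assms(1) assms(2) subset_refl, where h = h]
    integral_measure_pmf_real[OF assms(1)]
  by (simp add: mult.commute)

lemma expectation_mono_finite:
  fixes f g :: "'a \<Rightarrow> real"
  assumes "finite (set_pmf p)" "\<And>x. x \<in> set_pmf p \<Longrightarrow> f x \<le> g x"
  shows "measure_pmf.expectation p f \<le> measure_pmf.expectation p g"
  by (rule integral_mono_AE)
     (auto intro: integrable_measure_pmf_finite assms simp: AE_measure_pmf_iff)

lemma expectation_add_finite:
  fixes f g :: "'a \<Rightarrow> real"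
  assumes "finite (set_pmf p)"
  shows "measure_pmf.expectation p (\<lambda>x. f x + g x)
       = measure_pmf.expectation p f + measure_pmf.expectation p g"
  by (intro Bochner_Integration.integral_add integrable_measure_pmf_finite assms)

lemma UNIV_action: "(UNIV :: action set) = {Idle, Compressed, Uncompressed}"
  using action.exhaust by auto

lemma finite_action [simp]: "finite (A :: action set)"
  by (rule finite_subset[OF subset_UNIV]) (simp add: UNIV_action)

lemma finite_set_pmf_step [simp]: "finite (set_pmf (step M s \<delta>))"
  by (simp add: step_def)

lemma finite_set_pmf_run [simp]: "finite (set_pmf (run M \<pi> s0 t))"
  by (induction t) auto

lemma expectation_run_Suc:
  fixes H :: "(nat \<times> action) list \<times> nat \<Rightarrow> real"
  shows "measure_pmf.expectation (run M \<pi> s0 (Suc t)) H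
       = measure_pmf.expectation (run M \<pi> s0 t) (\<lambda>(h, s).
           measure_pmf.expectation (\<pi> h s) (\<lambda>\<delta>.
             measure_pmf.expectation (step M s \<delta>) (\<lambda>s'. H ((s, \<delta>) # h, s'))))"
  by (simp add: expectation_bind_pmf_finite case_prod_beta' split_beta)

definition expected_state :: "aosi_system \<Rightarrow> policy \<Rightarrow> nat \<Rightarrow> (nat \<Rightarrow> real) \<Rightarrow> nat \<Rightarrow> real" where
  "expected_state M \<pi> s0 \<phi> t = measure_pmf.expectation (run M \<pi> s0 t) (\<lambda>(h, s). \<phi> s)"

lemma expected_state_0 [simp]: "expected_state M \<pi> s0 \<phi> 0 = \<phi> s0"
  by (simp add: expected_state_def)

lemma expected_state_Suc:
  "expected_state M \<pi> s0 \<phi> (Suc t) = measure_pmf.expectation (run M \<pi> s0 t) (\<lambda>(h, s).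
     measure_pmf.expectation (\<pi> h s) (\<lambda>\<delta>. measure_pmf.expectation (step M s \<delta>) \<phi>))"
  by (simp add: expected_state_def expectation_run_Suc del: run.simps)

lemma expected_state_mono:
  assumes "\<And>s. \<phi> s \<le> \<psi> s"
  shows "expected_state M \<pi> s0 \<phi> t \<le> expected_state M \<pi> s0 \<psi> t"
  unfolding expected_state_def using assms by (intro expectation_mono_finite) auto

lemma expected_state_affine:
  "expected_state M \<pi> s0 (\<lambda>s. b * \<phi> s + c) t = b * expected_state M \<pi> s0 \<phi> t + c"
  by (simp add: expected_state_def case_prod_beta' integrable_measure_pmf_finite)

lemma total_cost_0 [simp]: "total_cost M \<pi> s0 0 = 0"
  by (simp add: total_cost_def)

lemma total_cost_Suc:
  "total_cost M \<pi> s0 (Suc t) = total_cost M \<pi> s0 t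
     + measure_pmf.expectation (run M \<pi> s0 t) (\<lambda>(h, s). measure_pmf.expectation (\<pi> h s) (cost M s))"
  unfolding total_cost_def expectation_run_Suc
  by (simp add: case_prod_beta' expectation_add_finite)

text \<open>Adding the expected \<open>V\<close> turns one more stage into an average of
  \<open>action_value\<close>, the quantity that the Bellman equation compares with
  \<open>\<theta> + V s\<close>.\<close>

lemma total_cost_Suc_action_value:
  "total_cost M \<pi> s0 (Suc t) + expected_state M \<pi> s0 V (Suc t) = total_cost M \<pi> s0 t
     + measure_pmf.expectation (run M \<pi> s0 t)
         (\<lambda>(h, s). measure_pmf.expectation (\<pi> h s) (action_value M V s))"
proof -
  have "action_value M V s = (\<lambda>\<delta>. cost M s \<delta> + measure_pmf.expectation (step M s \<delta>) V)" for s
    by (simp add: action_value_def fun_eq_iff)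
  then show ?thesis
    unfolding total_cost_Suc expected_state_Suc
    by (simp add: case_prod_beta' expectation_add_finite)
qed

text \<open>By the Bellman inequality, accumulated cost plus \<open>V\<close> minus
  \<open>\<theta> * t\<close> is a submartingale under every policy.\<close>

lemma total_cost_ge:
  assumes "\<And>s \<delta>. \<theta> + V s \<le> action_value M V s \<delta>"
  shows "total_cost M \<pi> s0 T + expected_state M \<pi> s0 V T \<ge> \<theta> * real T + V s0"
proof (induction T)
  case (Suc t)
  \<comment> \<open>The factor 1 gives the integrand the shape that
    \<open>expected_state_affine\<close> rewrites.\<close>
  have "expected_state M \<pi> s0 (\<lambda>s. 1 * V s + \<theta>) t
      \<le> measure_pmf.expectation (run M \<pi> s0 t)
          (\<lambda>(h, s). measure_pmf.expectation (\<pi> h s) (action_value M V s))"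
    unfolding expected_state_def
  proof (rule expectation_mono_finite)
    fix x
    have "measure_pmf.expectation (\<pi> (fst x) (snd x)) (\<lambda>_. V (snd x) + \<theta>)
        \<le> measure_pmf.expectation (\<pi> (fst x) (snd x)) (action_value M V (snd x))"
      using assms by (intro expectation_mono_finite) (auto simp: add.commute)
    then show "(case x of (h, s) \<Rightarrow> 1 * V s + \<theta>)
        \<le> (case x of (h, s) \<Rightarrow> measure_pmf.expectation (\<pi> h s) (action_value M V s))"
      by (simp add: case_prod_beta')
  qed simp
  with Suc show ?case
    unfolding total_cost_Suc_action_value expected_state_affine by (simp add: algebra_simps)
qed simp

text \<open>Equality at the chosen actions turns the submartingale into a martingale.\<close>

lemma total_cost_stationary:
  assumes "\<And>s. action_value M V s (f s) = \<theta> + V s"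
  shows "total_cost M (stationary f) s0 T + expected_state M (stationary f) s0 V T
       = \<theta> * real T + V s0"
proof (induction T)
  case (Suc t)
  show ?case
    unfolding total_cost_Suc_action_value using Suc
    by (simp add: stationary_def assms expected_state_def case_prod_beta'
        integrable_measure_pmf_finite algebra_simps)
qed simp

text \<open>A lower bound of \<open>V\<close> keeps the total cost below \<open>\<theta> * T\<close>
  plus a constant, which vanishes after division by \<open>T\<close>.\<close>

lemma average_cost_stationary_le:
  assumes "bdd_below (range V)" "\<And>s. action_value M V s (f s) = \<theta> + V s"
  shows "average_cost M (stationary f) s0 \<le> ereal \<theta>"
proof -
  obtain c where c: "\<And>s. c \<le> V s" using assms(1) by (auto simp: bdd_below_def)
  have le: "total_cost M (stationary f) s0 T \<le> \<theta> * real T + (V s0 - c)" for T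
    using total_cost_stationary[OF assms(2), of s0 T]
      expected_state_mono[of "\<lambda>s. 0 * V s + c" V M "stationary f" s0 T] c
    unfolding expected_state_affine by simp
  have "average_cost M (stationary f) s0
      \<le> liminf (\<lambda>T. ereal (\<theta> + (V s0 - c) * (1 / real T)))"
    unfolding average_cost_def
  proof (rule Liminf_mono, rule eventually_mono[OF eventually_gt_at_top[of 0]])
    fix T :: nat assume "0 < T"
    then show "ereal (total_cost M (stationary f) s0 T / real T)
        \<le> ereal (\<theta> + (V s0 - c) * (1 / real T))"
      using le[of T] by (simp add: field_simps)
  qed
  also have "\<dots> = ereal \<theta>"
  proof (rule lim_imp_Liminf)
    have "(\<lambda>T. \<theta> + (V s0 - c) * (1 / real T)) \<longlonglongrightarrow> \<theta> + (V s0 - c) * 0"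
      by (intro tendsto_intros lim_1_over_n)
    then show "(\<lambda>T. ereal (\<theta> + (V s0 - c) * (1 / real T))) \<longlonglongrightarrow> ereal \<theta>"
      by simp
  qed simp
  finally show ?thesis .
qed

text \<open>The least element of \<open>P\<close> serves; an empty \<open>P\<close> gives
  \<infinity>, hence the type \<open>enat\<close>.\<close>

lemma up_closed_threshold:
  fixes P :: "nat \<Rightarrow> bool"
  assumes "\<And>s t. P s \<Longrightarrow> s \<le> t \<Longrightarrow> P t"
  obtains n :: enat where "\<And>s. enat s < n \<longleftrightarrow> \<not> P s"
proof (cases "\<exists>s. P s")
  case True
  then have "enat s < enat (LEAST s. P s) \<longleftrightarrow> \<not> P s" for s
    using assms not_less_Least LeastI_ex[OF True] by (metis enat_ord_simps(2) not_less)
  then show ?thesis using that by blast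
next
  case False
  then show ?thesis using that[of \<infinity>] by simp
qed

section \<open>The model under its standing assumptions, and growth of the expected state\<close>

locale aosi =
  fixes M :: aosi_system
  assumes r0: "0 \<le> r0 M" "r0 M \<le> 1"
    and r1: "0 \<le> r1 M" "r1 M \<le> 1"
    and r0_r1: "r0 M + r1 M \<ge> 1"
    and rho: "0 \<le> rho M" "rho M \<le> 1"
    and p: "0 \<le> p1 M" "p1 M < p2 M" "p2 M \<le> 1"
    and energies: "0 \<le> energy1 M" "energy1 M < energy2 M"
begin

fun energy :: "action \<Rightarrow> real" where
  "energy Idle = 0"
| "energy Compressed = energy1 M"
| "energy Uncompressed = energy2 M"

text \<open>The probability that a transmission is decoded and then stabilizes the source.\<close>

fun efficacy :: "action \<Rightarrow> real" where
  "efficacy Idle = 0"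
| "efficacy Compressed = rho M * p1 M"
| "efficacy Uncompressed = rho M * p2 M"

lemma energy_nonneg: "0 \<le> energy \<delta>"
  using energies by (cases \<delta>) auto

lemma efficacy_bounds: "0 \<le> efficacy \<delta>" "efficacy \<delta> \<le> 1"
  using rho p by (cases \<delta>; auto intro: mult_le_one)+

lemma efficacy_le: "efficacy Compressed \<le> efficacy Uncompressed"
  using rho p by (auto intro: mult_left_mono)

lemma drift_bounds: "0 \<le> drift M s" "drift M s \<le> 1"
  using r0 r1 by (auto simp: drift_def)

lemma cost_eq: "cost M s \<delta> = real s + energy \<delta>"
  by (cases \<delta>) auto

lemma up_prob_eq: "up_prob M s \<delta> = drift M s * (1 - efficacy \<delta>)"
  by (cases \<delta>) (auto simp: algebra_simps)

lemma up_prob_bounds: "0 \<le> up_prob M s \<delta>" "up_prob M s \<delta> \<le> 1"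
  unfolding up_prob_eq using drift_bounds[of s] efficacy_bounds[of \<delta>]
  by (auto intro: mult_nonneg_nonneg mult_le_one)

lemma expectation_step:
  fixes \<phi> :: "nat \<Rightarrow> real"
  shows "measure_pmf.expectation (step M s \<delta>) \<phi>
       = up_prob M s \<delta> * \<phi> (Suc s) + (1 - up_prob M s \<delta>) * \<phi> 0"
  by (simp add: step_def up_prob_bounds)

lemma action_value_eq:
  "action_value M V s \<delta>
   = real s + V 0 + (energy \<delta> + (1 - efficacy \<delta>) * (drift M s * (V (Suc s) - V 0)))"
  by (simp add: action_value_def expectation_step cost_eq up_prob_eq algebra_simps)

lemma expected_state_Suc_le:
  "expected_state M \<pi> s0 real (Suc t) \<le> expected_state M \<pi> s0 real t + 1"
proof -
  have "expected_state M \<pi> s0 real (Suc t) \<le> expected_state M \<pi> s0 (\<lambda>s. 1 * real s + 1) t"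
    unfolding expected_state_Suc unfolding expected_state_def
  proof (rule expectation_mono_finite)
    fix x
    have "up_prob M s \<delta> * (real s + 1) \<le> 1 * (real s + 1)" for s \<delta>
      using up_prob_bounds by (intro mult_right_mono) auto
    then have "measure_pmf.expectation (\<pi> (fst x) (snd x))
          (\<lambda>\<delta>. measure_pmf.expectation (step M (snd x) \<delta>) real)
        \<le> measure_pmf.expectation (\<pi> (fst x) (snd x)) (\<lambda>_. real (snd x) + 1)"
      by (intro expectation_mono_finite) (auto simp: expectation_step add.commute)
    then show "(case x of (h, s) \<Rightarrow> measure_pmf.expectation (\<pi> h s)
          (\<lambda>\<delta>. measure_pmf.expectation (step M s \<delta>) real))
        \<le> (case x of (h, s) \<Rightarrow> 1 * real s + 1)"
      by (simp add: case_prod_beta')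
  qed simp
  then show ?thesis unfolding expected_state_affine by simp
qed

lemma total_cost_Suc_ge:
  "total_cost M \<pi> s0 (Suc t) \<ge> total_cost M \<pi> s0 t + expected_state M \<pi> s0 real t"
proof -
  have "expected_state M \<pi> s0 real t \<le> measure_pmf.expectation (run M \<pi> s0 t)
          (\<lambda>(h, s). measure_pmf.expectation (\<pi> h s) (cost M s))"
    unfolding expected_state_def
  proof (rule expectation_mono_finite)
    fix x
    have "measure_pmf.expectation (\<pi> (fst x) (snd x)) (\<lambda>_. real (snd x))
        \<le> measure_pmf.expectation (\<pi> (fst x) (snd x)) (cost M (snd x))"
      using energy_nonneg by (intro expectation_mono_finite) (auto simp: cost_eq)
    then show "(case x of (h, s) \<Rightarrow> real s)
        \<le> (case x of (h, s) \<Rightarrow> measure_pmf.expectation (\<pi> h s) (cost M s))"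
      by (simp add: case_prod_beta')
  qed simp
  then show ?thesis by (simp add: total_cost_Suc)
qed

lemma total_cost_nonneg: "0 \<le> total_cost M \<pi> s0 t"
proof (induction t)
  case (Suc t)
  have "0 \<le> expected_state M \<pi> s0 real t"
    unfolding expected_state_def by (intro integral_nonneg_AE) auto
  with Suc total_cost_Suc_ge[of \<pi> s0 t] show ?case by linarith
qed simp

text \<open>Going back \<open>j\<close> steps lowers the expected state by at most \<open>j\<close>,
  so each of the last \<open>N\<close> stages costs at least the final expected state minus
  \<open>N\<close>.\<close>

lemma total_cost_ge_expected_state:
  "total_cost M \<pi> s0 (T + N) \<ge> real N * expected_state M \<pi> s0 real (T + N) - (real N)\<^sup>2"
proof (induction N)
  case 0
  then show ?case by (simp add: total_cost_nonneg)
next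
  case (Suc N)
  have "real (Suc N) * expected_state M \<pi> s0 real (Suc (T + N))
      \<le> real (Suc N) * (expected_state M \<pi> s0 real (T + N) + 1)"
    by (intro mult_left_mono expected_state_Suc_le) simp
  with Suc total_cost_Suc_ge[of \<pi> s0 "T + N"] show ?case
    by (simp add: algebra_simps power2_eq_square)
qed

subsection \<open>Verification\<close>

text \<open>As \<open>V\<close> may grow linearly, its expectation at time \<open>T\<close> need not
  be negligible. A large expected state however forces a total cost about \<open>N\<close> times as
  large, so this term is absorbed at the price of the factor \<open>1 + b / real N\<close>. Then
  \<open>T\<close> tends to infinity for fixed \<open>N\<close>, and \<open>N\<close>
  afterwards.\<close>

lemma average_cost_ge:
  assumes bellman: "\<And>s \<delta>. \<theta> + V s \<le> action_value M V s \<delta>"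
    and growth: "\<And>s. V s \<le> b * real s + b'" and b: "0 \<le> b"
  shows "ereal \<theta> \<le> average_cost M \<pi> s0"
proof -
  define c where "c = b' - V s0"
  have bound: "ereal (\<theta> / (1 + b / real N)) \<le> average_cost M \<pi> s0" if N: "0 < N" for N :: nat
  proof -
    let ?d = "1 + b / real N"
    have d: "?d > 0" using b by (simp add: add_pos_nonneg)
    have total: "(\<theta> * real T - c - b * real N) / ?d \<le> total_cost M \<pi> s0 T" if T: "N \<le> T" for T
    proof -
      let ?x = "expected_state M \<pi> s0 real T" and ?t = "total_cost M \<pi> s0 T"
      have "expected_state M \<pi> s0 V T \<le> b * ?x + b'"
        unfolding expected_state_affine[symmetric] by (rule expected_state_mono) (rule growth)
      then have 1: "\<theta> * real T - c \<le> ?t + b * ?x"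
        using total_cost_ge[OF bellman, where T = T and \<pi> = \<pi> and ?s0.0 = s0] by (simp add: c_def)
      have "real N * ?x \<le> ?t + (real N)\<^sup>2"
        using total_cost_ge_expected_state[where N = N and T = "T - N" and \<pi> = \<pi> and ?s0.0 = s0] T by simp
      then have "?x \<le> ?t / real N + real N"
        using N by (simp add: field_simps power2_eq_square)
      then have "b * ?x \<le> b * (?t / real N + real N)"
        using b by (rule mult_left_mono)
      with 1 have "\<theta> * real T - c - b * real N \<le> ?t * ?d"
        by (simp add: algebra_simps)
      then show ?thesis using d by (simp add: pos_divide_le_eq)
    qed
    have "ereal (\<theta> / ?d) = liminf (\<lambda>T. ereal ((\<theta> - (c + b * real N) * (1 / real T)) / ?d))"
    proof (rule lim_imp_Liminf[symmetric])
      have "(\<lambda>T. (\<theta> - (c + b * real N) * (1 / real T)) / ?d)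
          \<longlonglongrightarrow> (\<theta> - (c + b * real N) * 0) / ?d"
        using d by (intro tendsto_intros lim_1_over_n) auto
      then show "(\<lambda>T. ereal ((\<theta> - (c + b * real N) * (1 / real T)) / ?d))
          \<longlonglongrightarrow> ereal (\<theta> / ?d)"
        by simp
    qed simp
    also have "\<dots> \<le> average_cost M \<pi> s0"
      unfolding average_cost_def
    proof (rule Liminf_mono, rule eventually_mono[OF eventually_ge_at_top[of N]])
      fix T assume T: "N \<le> T"
      then have "(\<theta> - (c + b * real N) * (1 / real T)) / ?d
          = (\<theta> * real T - c - b * real N) / ?d / real T"
        using N d by (simp add: divide_simps)
      also have "\<dots> \<le> total_cost M \<pi> s0 T / real T"
        using total[OF T] by (rule divide_right_mono) simp
      finally show "ereal ((\<theta> - (c + b * real N) * (1 / real T)) / ?d)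
          \<le> ereal (total_cost M \<pi> s0 T / real T)"
        by simp
    qed
    finally show ?thesis .
  qed
  have "(\<lambda>N. \<theta> / (1 + b * (1 / real N))) \<longlonglongrightarrow> \<theta> / (1 + b * 0)"
    by (intro tendsto_intros lim_1_over_n) simp
  then have "(\<lambda>N. ereal (\<theta> / (1 + b / real N))) \<longlonglongrightarrow> ereal \<theta>"
    by simp
  then show ?thesis
    \<comment> \<open>Here \<open>M\<close> is the index from which the bound holds, not the
      system.\<close>
    by (rule Lim_bounded[where M = 1]) (simp add: bound)
qed

text \<open>Verification: linear growth of \<open>V\<close> bounds every policy from below, and
  boundedness below of \<open>V\<close> lets the policy \<open>f\<close> attain that bound.\<close>

lemma optimal_value_eq:
  assumes "bdd_below (range V)" "\<And>s. V s \<le> b * real s + b'" "0 \<le> b"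
    and "\<And>s \<delta>. \<theta> + V s \<le> action_value M V s \<delta>"
    and "\<And>s. action_value M V s (f s) = \<theta> + V s"
  shows "optimal_value M s0 = ereal \<theta>"
  unfolding optimal_value_def
proof (rule antisym)
  show "(INF \<pi>. average_cost M \<pi> s0) \<le> ereal \<theta>"
    by (rule INF_lower2[of "stationary f"]) (auto intro: average_cost_stationary_le assms)
  show "ereal \<theta> \<le> (INF \<pi>. average_cost M \<pi> s0)"
    by (intro INF_greatest average_cost_ge[where V = V and b = b and b' = b'] assms)
qed

subsection \<open>The envelope of the three actions\<close>

text \<open>The nonlinear part of the Bellman equation: a concave, piecewise affine function with
  slopes between 0 and 1.\<close>

definition envelope :: "real \<Rightarrow> real" where
  "envelope x = Min ((\<lambda>\<delta>. energy \<delta> + (1 - efficacy \<delta>) * x) ` UNIV)"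

lemma envelope_eq:
  "envelope x = min x (min (energy1 M + (1 - efficacy Compressed) * x)
                           (energy2 M + (1 - efficacy Uncompressed) * x))"
  by (simp add: envelope_def UNIV_action)

lemma envelope_le: "envelope x \<le> energy \<delta> + (1 - efficacy \<delta>) * x"
  unfolding envelope_def by (rule Min_le) auto

lemma envelope_attained: "\<exists>\<delta>. envelope x = energy \<delta> + (1 - efficacy \<delta>) * x"
proof -
  have "envelope x \<in> range (\<lambda>\<delta>. energy \<delta> + (1 - efficacy \<delta>) * x)"
    unfolding envelope_def by (rule Min_in) auto
  then show ?thesis by blast
qed

lemma envelope_mono: "x \<le> y \<Longrightarrow> envelope x \<le> envelope y"
proof -
  assume "x \<le> y"
  obtain \<delta> where \<delta>: "envelope y = energy \<delta> + (1 - efficacy \<delta>) * y"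
    using envelope_attained by blast
  have "(1 - efficacy \<delta>) * x \<le> (1 - efficacy \<delta>) * y"
    using \<open>x \<le> y\<close> efficacy_bounds by (intro mult_left_mono) auto
  then show ?thesis using \<delta> envelope_le[of x \<delta>] by linarith
qed

text \<open>The action optimal at \<open>x\<close> remains available at \<open>y\<close>, and its
  slope is at most 1.\<close>

lemma envelope_diff: "x \<le> y \<Longrightarrow> envelope y - envelope x \<le> y - x"
proof -
  assume "x \<le> y"
  obtain \<delta> where \<delta>: "envelope x = energy \<delta> + (1 - efficacy \<delta>) * x"
    using envelope_attained by blast
  have "(1 - efficacy \<delta>) * (y - x) \<le> 1 * (y - x)"
    using \<open>x \<le> y\<close> efficacy_bounds by (intro mult_right_mono) auto
  then show ?thesis using \<delta> envelope_le[of y \<delta>] by (simp add: algebra_simps)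
qed

lemma envelope_nonneg: "0 \<le> x \<Longrightarrow> 0 \<le> envelope x"
  using envelope_attained[of x] energy_nonneg efficacy_bounds by fastforce

lemma continuous_on_envelope:
  "continuous_on S f \<Longrightarrow> continuous_on S (\<lambda>x. envelope (f x))"
  unfolding envelope_eq by (intro continuous_intros)

lemma Min_action_value:
  "Min (action_value M V s ` {Idle, Compressed, Uncompressed})
   = real s + V 0 + envelope (drift M s * (V (Suc s) - V 0))"
  by (simp add: action_value_eq envelope_eq min_add_distrib_right add.assoc[symmetric])

subsection \<open>Solutions of the Bellman equation are monotone\<close>

text \<open>The truncation at 0 covers states with \<open>V (Suc s) < V 0\<close>, where a larger
  drift could lower the product; idling is optimal there.\<close>

lemma bellman_drift_mono:
  assumes V: "bdd_below (range V)"
    and bellman: "\<And>s. \<theta> + V s = real s + V 0 + envelope (drift M s * (V (Suc s) - V 0))"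
  shows "mono (\<lambda>s. max 0 (drift M s * (V (Suc s) - V 0)))"
proof -
  \<comment> \<open>Subtract the Bellman equations at \<open>s\<close> and \<open>Suc s\<close>,
    which share the drift \<open>r1 M\<close> as \<open>0 < s\<close>. Since \<open>envelope\<close>
    and the factor \<open>r1 M\<close> do not expand distances, the unit increase of the stage cost
    makes the next drop larger by at least 1.\<close>
  have decr: "V (Suc (Suc s)) - V (Suc s) \<le> V (Suc s) - V s - 1"
    if s: "0 < s" and "V (Suc s) < V s" for s
  proof -
    let ?x = "r1 M * (V (Suc s) - V 0)" and ?y = "r1 M * (V (Suc (Suc s)) - V 0)"
    have eq: "V (Suc s) - V s = 1 + envelope ?y - envelope ?x"
      using bellman[of s] bellman[of "Suc s"] s by (simp add: drift_def)
    with that have "envelope ?y < envelope ?x" by linarith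
    then have "?y < ?x" using envelope_mono not_le by metis
    then have "r1 M * (V (Suc (Suc s)) - V (Suc s)) < 0" by (simp add: algebra_simps)
    then have "V (Suc (Suc s)) - V (Suc s) < 0"
      using r1 by (simp add: mult_less_0_iff)
    then have "1 * (V (Suc (Suc s)) - V (Suc s)) \<le> r1 M * (V (Suc (Suc s)) - V (Suc s))"
      using r1 by (intro mult_right_mono_neg) auto
    also have "\<dots> = ?y - ?x" by (simp add: algebra_simps)
    also have "\<dots> \<le> envelope ?y - envelope ?x"
      using envelope_diff[of ?y ?x] \<open>?y < ?x\<close> by linarith
    finally show ?thesis using eq by simp
  qed
  have incr: "V s \<le> V (Suc s)" if "0 < s" for s
  proof (rule ccontr)
    assume neg: "\<not> V s \<le> V (Suc s)"
    have steps: "V (Suc (s + k)) < V (s + k) \<and> V (Suc (s + k)) - V (s + k) \<le> - real k" for k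
    proof (induction k)
      case 0
      then show ?case using neg by simp
    next
      case (Suc k)
      then show ?case using decr[of "s + k"] \<open>0 < s\<close> by auto
    qed
    \<comment> \<open>From \<open>s + 1\<close> on, every drop is at least 1; linear descent already
      contradicts the lower bound.\<close>
    have descent: "V (s + 1 + k) \<le> V (s + 1) - real k" for k
    proof (induction k)
      case (Suc k)
      then show ?case using steps[of "Suc k"] by simp
    qed simp
    obtain c where c: "\<And>s. c \<le> V s" using V by (auto simp: bdd_below_def)
    obtain k :: nat where "V (s + 1) - c < real k" using reals_Archimedean2 by blast
    with descent[of k] c[of "s + 1 + k"] show False by linarith
  qed
  show ?thesis
    unfolding mono_iff_le_Suc
  proof
    fix s
    show "max 0 (drift M s * (V (Suc s) - V 0))
        \<le> max 0 (drift M (Suc s) * (V (Suc (Suc s)) - V 0))"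
    proof (cases "0 \<le> V (Suc s) - V 0")
      case True
      \<comment> \<open>The condition on \<open>r0 M + r1 M\<close> says that the drift does not
        decrease from 0 to 1.\<close>
      have "drift M s \<le> drift M (Suc s)" using r0_r1 by (simp add: drift_def)
      then have "drift M s * (V (Suc s) - V 0) \<le> drift M (Suc s) * (V (Suc (Suc s)) - V 0)"
        using True incr[of "Suc s"] drift_bounds by (intro mult_mono) auto
      then show ?thesis by simp
    next
      case False
      then have "drift M s * (V (Suc s) - V 0) \<le> 0"
        using drift_bounds[of s] by (simp add: mult_nonneg_nonpos)
      then show ?thesis by simp
    qed
  qed
qed

text \<open>With \<open>V\<close> bounded below, the envelope term is at least a constant, so the
  stage cost drives \<open>V s\<close> to infinity. This makes the thresholds finite.\<close>

lemma bellman_drift_unbounded: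
  assumes V: "bdd_below (range V)"
    and bellman: "\<And>s. \<theta> + V s = real s + V 0 + envelope (drift M s * (V (Suc s) - V 0))"
    and r: "0 < r1 M"
  shows "\<exists>s. K \<le> drift M s * (V (Suc s) - V 0)"
proof -
  obtain c where c: "\<And>s. c \<le> V s" using V by (auto simp: bdd_below_def)
  define d where "d = envelope (r1 M * (c - V 0))"
  obtain s :: nat where s: "K / r1 M + \<theta> - d < real s" using reals_Archimedean2 by blast
  have "d \<le> envelope (drift M (Suc (Suc s)) * (V (Suc (Suc (Suc s))) - V 0))"
    unfolding d_def drift_def using c r by (auto intro!: envelope_mono mult_left_mono)
  then have "K / r1 M \<le> V (Suc (Suc s)) - V 0"
    using bellman[of "Suc (Suc s)"] s by simp
  then show ?thesis
    using r by (intro exI[of _ "Suc s"]) (simp add: drift_def pos_divide_le_eq mult.commute)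
qed

lemma threshold_policy_is_arg_min:
  assumes V: "bdd_below (range V)"
    and bellman: "\<And>s. \<theta> + V s = real s + V 0 + envelope (drift M s * (V (Suc s) - V 0))"
  shows "\<exists>n1 n2. n1 \<le> n2 \<and> (0 < rho M \<and> 0 < r1 M \<longrightarrow> n2 < \<infinity>) \<and>
           (\<forall>s. is_arg_min (action_value M V s) (\<lambda>_. True) (threshold n1 n2 s))"
proof -
  define D where "D s = drift M s * (V (Suc s) - V 0)" for s
  let ?b1 = "efficacy Compressed" and ?b2 = "efficacy Uncompressed"
  \<comment> \<open>\<open>P\<close>: some transmission strictly beats idling. \<open>Q\<close>:
    moreover, the uncompressed one is at least as good as the compressed one. Ties with idling go to
    \<open>Idle\<close>, and \<open>Q\<close> includes \<open>P\<close> so that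
    \<open>n1 \<le> n2\<close>.\<close>
  define P where "P s \<longleftrightarrow> energy1 M < ?b1 * max 0 (D s) \<or> energy2 M < ?b2 * max 0 (D s)" for s
  define Q where
    "Q s \<longleftrightarrow> P s \<and> energy2 M - energy1 M \<le> (?b2 - ?b1) * max 0 (D s)" for s
  have mono: "max 0 (D s) \<le> max 0 (D t)" if "s \<le> t" for s t
    using bellman_drift_mono[OF V bellman] that unfolding D_def mono_def by blast
  have scale: "k * max 0 (D s) \<le> k * max 0 (D t)" if "s \<le> t" "0 \<le> k" for s t k
    using mono that by (intro mult_left_mono)
  have P_up: "P t" if "P s" "s \<le> t" for s t
    using scale[OF that(2), of ?b1] scale[OF that(2), of ?b2] efficacy_bounds that
    unfolding P_def by fastforce
  have Q_up: "Q t" if "Q s" "s \<le> t" for s t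
    using scale[OF that(2), of "?b2 - ?b1"] efficacy_le P_up that
    unfolding Q_def by fastforce
  obtain n1 where n1: "\<And>s. enat s < n1 \<longleftrightarrow> \<not> P s" using up_closed_threshold[of P] P_up by metis
  obtain n2 where n2: "\<And>s. enat s < n2 \<longleftrightarrow> \<not> Q s" using up_closed_threshold[of Q] Q_up by metis
  have "n1 \<le> n2"
  proof (rule ccontr)
    assume "\<not> n1 \<le> n2"
    then have "n2 < n1" by simp
    then obtain k where "n2 = enat k" by (cases n2) auto
    with \<open>n2 < n1\<close> n1[of k] n2[of k] show False by (simp add: Q_def)
  qed
  moreover have "n2 < \<infinity>" if pos_r: "0 < rho M" "0 < r1 M"
  proof -
    have pos: "0 < ?b2 - ?b1" "0 < ?b2"
      using that p by (auto simp: right_diff_distrib[symmetric])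
    \<comment> \<open>The points where \<open>Uncompressed\<close> breaks even with
      \<open>Compressed\<close> and with \<open>Idle\<close>; the added 1 makes the preference over
      \<open>Idle\<close> strict.\<close>
    define K where "K = max ((energy2 M - energy1 M) / (?b2 - ?b1)) (energy2 M / ?b2 + 1)"
    obtain s where "K \<le> D s"
      using bellman_drift_unbounded[OF V bellman pos_r(2)] unfolding D_def by blast
    then have "(energy2 M - energy1 M) / (?b2 - ?b1) \<le> max 0 (D s)" "energy2 M / ?b2 < max 0 (D s)"
      by (auto simp: K_def)
    then have "Q s" using pos by (simp add: Q_def P_def pos_divide_le_eq pos_divide_less_eq mult.commute)
    then show ?thesis using n2[of s] by (metis enat_ord_simps(4) not_infinity_eq)
  qed
  moreover have "is_arg_min (action_value M V s) (\<lambda>_. True) (threshold n1 n2 s)" for s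
  proof -
    have "energy (threshold n1 n2 s) - efficacy (threshold n1 n2 s) * D s
        \<le> energy \<delta> - efficacy \<delta> * D s" for \<delta>
    proof (cases "0 \<le> D s")
      case True
      then have "max 0 (D s) = D s" by simp
      then show ?thesis
        using n1[of s] n2[of s] unfolding threshold_def P_def Q_def
        by (cases \<delta>) (auto simp: left_diff_distrib)
    next
      case False
      then have "\<not> P s" using energies by (simp add: P_def)
      moreover have "efficacy \<delta> * D s \<le> 0"
        using False efficacy_bounds by (simp add: mult_nonneg_nonpos)
      ultimately show ?thesis
        using n1[of s] energy_nonneg[of \<delta>] by (simp add: threshold_def)
    qed
    then show ?thesis
      unfolding is_arg_min_def action_value_eq D_def[symmetric]
      by (auto simp: not_less left_diff_distrib algebra_simps)
  qed
  ultimately show ?thesis by blast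
qed

text \<open>\<open>bellman_solution\<close> identifies \<theta> with the optimal value, so
  optimality only requires the upper bound on the cost of the threshold policy.\<close>

lemma bellman_solution_threshold:
  assumes "bellman_solution M \<theta> V"
  shows "\<exists>n1 n2. n1 \<le> n2 \<and> (0 < rho M \<and> 0 < r1 M \<longrightarrow> n2 < \<infinity>) \<and>
           (\<forall>s. is_arg_min (action_value M V s) (\<lambda>_. True) (threshold n1 n2 s)) \<and>
           optimal_policy M (stationary (threshold n1 n2))"
proof -
  have opt: "\<And>s0. optimal_value M s0 = ereal \<theta>" and V: "bdd_below (range V)"
    and eq: "\<And>s. \<theta> + V s = Min (action_value M V s ` {Idle, Compressed, Uncompressed})"
    using assms by (auto simp: bellman_solution_def)
  obtain n1 n2 where n: "n1 \<le> n2" "0 < rho M \<and> 0 < r1 M \<longrightarrow> n2 < \<infinity>"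
    and arg_min: "\<And>s. is_arg_min (action_value M V s) (\<lambda>_. True) (threshold n1 n2 s)"
    using threshold_policy_is_arg_min[OF V, of \<theta>] eq unfolding Min_action_value by blast
  have "action_value M V s (threshold n1 n2 s) = \<theta> + V s" for s
    unfolding eq UNIV_action[symmetric]
    using arg_min[of s] by (intro Min_eqI[symmetric]) (auto simp: is_arg_min_def not_less)
  then have "average_cost M (stationary (threshold n1 n2)) s0 \<le> optimal_value M s0" for s0
    unfolding opt by (rule average_cost_stationary_le[OF V])
  moreover have "optimal_value M s0 \<le> average_cost M (stationary (threshold n1 n2)) s0" for s0
    unfolding optimal_value_def by (rule INF_lower) simp
  ultimately have "optimal_policy M (stationary (threshold n1 n2))"
    by (simp add: optimal_policy_def antisym)
  with n arg_min show ?thesis by blast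
qed

subsection \<open>Existence of a solution\<close>

definition tail_action :: action where
  "tail_action = (if rho M = 0 \<or> r1 M = 0 then Idle else Uncompressed)"

definition tail_rate :: real where
  "tail_rate = r1 M * (1 - efficacy tail_action)"

definition tail_slope :: real where
  "tail_slope = 1 / (1 - tail_rate)"

text \<open>The affine solution of the linear recursion obtained by always using
  \<open>tail_action\<close> at drift \<open>r1 M\<close>, with \<open>V 0\<close> normalized to
  0.\<close>

definition tail :: "real \<Rightarrow> nat \<Rightarrow> real" where
  "tail \<theta> s = tail_slope * real s
     + (energy tail_action - \<theta> + tail_rate * tail_slope) / (1 - tail_rate)"

text \<open>Value iteration over \<open>k\<close> steps with terminal value \<open>tail\<close>. The
  drift \<open>r1 M\<close> is used at every \<open>s\<close>, so the value at 0 is only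
  formal.\<close>

primrec backward :: "real \<Rightarrow> nat \<Rightarrow> nat \<Rightarrow> real" where
  "backward \<theta> 0 s = tail \<theta> s"
| "backward \<theta> (Suc k) s = real s - \<theta> + envelope (r1 M * backward \<theta> k (Suc s))"

lemma tail_rate_nonneg: "0 \<le> tail_rate"
  using r1 efficacy_bounds by (simp add: tail_rate_def)

text \<open>Either idling leaves a positive chance of recovery, or the uncompressed transmission
  provides one.\<close>

lemma tail_rate_less:
  assumes "0 < rho M \<or> r1 M < 1"
  shows "tail_rate < 1"
proof (cases "rho M = 0 \<or> r1 M = 0")
  case True
  then show ?thesis using assms r1 by (auto simp: tail_rate_def tail_action_def)
next
  case False
  then have "0 < rho M * p2 M" using rho p by simp
  then have "r1 M * (1 - rho M * p2 M) < r1 M * 1"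
    using False r1 by (intro mult_strict_left_mono) auto
  then have "r1 M * (1 - rho M * p2 M) < 1" using r1 by linarith
  then show ?thesis using False unfolding tail_rate_def tail_action_def by auto
qed

context
  assumes nondegenerate: "0 < rho M \<or> r1 M < 1"
begin

lemma tail_slope_ge: "1 \<le> tail_slope"
  using tail_rate_less[OF nondegenerate] tail_rate_nonneg by (simp add: tail_slope_def)

lemma tail_eq:
  "tail \<theta> s = real s - \<theta> + (energy tail_action
     + (1 - efficacy tail_action) * (r1 M * tail \<theta> (Suc s)))"
proof -
  have ne: "1 - tail_rate \<noteq> 0" using tail_rate_less[OF nondegenerate] by simp
  have "tail \<theta> s = real s - \<theta> + energy tail_action + tail_rate * tail \<theta> (Suc s)"
    using ne by (simp add: tail_def tail_slope_def divide_simps) (simp add: algebra_simps)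
  then show ?thesis by (simp add: tail_rate_def algebra_simps)
qed

lemma tail_antimono: "\<theta> \<le> \<theta>' \<Longrightarrow> tail \<theta>' s \<le> tail \<theta> s"
  using tail_rate_less[OF nondegenerate] by (simp add: tail_def divide_right_mono)

lemma tail_ge: "tail \<theta> s \<ge> real s + tail \<theta> 0"
proof -
  have "1 * real s \<le> tail_slope * real s"
    using tail_slope_ge by (intro mult_right_mono) auto
  then show ?thesis by (simp add: tail_def)
qed

lemma tail_nonneg: "0 \<le> tail 0 s"
  using tail_rate_less[OF nondegenerate] tail_rate_nonneg tail_slope_ge energy_nonneg
  by (simp add: tail_def)

text \<open>One \<open>S\<close> serves all \<theta> up to \<open>\<Theta>\<close> because
  \<open>tail\<close> decreases in \<theta>. The number of backward steps can thus be fixed, which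
  keeps the result continuous in \<theta>.\<close>

lemma tail_solves:
  "\<exists>S. \<forall>\<theta> \<le> \<Theta>. \<forall>s \<ge> S. tail \<theta> s = real s - \<theta> + envelope (r1 M * tail \<theta> (Suc s))"
proof (cases "rho M = 0 \<or> r1 M = 0")
  case True
  then have "envelope (r1 M * x) = r1 M * x" for x
    using energies by (auto simp: envelope_eq)
  moreover have "tail \<theta> s = real s - \<theta> + r1 M * tail \<theta> (Suc s)" for \<theta> s
    using True by (subst tail_eq) (simp add: tail_action_def)
  ultimately show ?thesis by (metis)
next
  case False
  then have r: "0 < r1 M" and "0 < rho M" using r1 rho by auto
  then have pos: "0 < efficacy Uncompressed - efficacy Compressed" "0 < efficacy Uncompressed"
    using p by (auto simp: right_diff_distrib[symmetric])
  define K where "K = max ((energy2 M - energy1 M) / (efficacy Uncompressed - efficacy Compressed))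
    (energy2 M / efficacy Uncompressed)"
  have env: "envelope x = energy Uncompressed + (1 - efficacy Uncompressed) * x" if "K \<le> x" for x
  proof -
    have "energy2 M - energy1 M \<le> (efficacy Uncompressed - efficacy Compressed) * x"
      "energy2 M \<le> efficacy Uncompressed * x"
      using that pos by (auto simp: K_def pos_divide_le_eq mult.commute)
    then show ?thesis by (simp add: envelope_eq algebra_simps)
  qed
  obtain S :: nat where S: "K / r1 M - tail \<Theta> 0 < real S" using reals_Archimedean2 by blast
  have "tail \<theta> s = real s - \<theta> + envelope (r1 M * tail \<theta> (Suc s))"
    if "\<theta> \<le> \<Theta>" "S \<le> s" for \<theta> s
  proof -
    have "K / r1 M \<le> tail \<theta> (Suc s)"
      using S that tail_antimono[OF that(1), of 0] tail_ge[of "Suc s" \<theta>] by simp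
    then have "K \<le> r1 M * tail \<theta> (Suc s)" using r by (simp add: pos_divide_le_eq mult.commute)
    then show ?thesis
      using False by (subst tail_eq) (simp add: env tail_action_def)
  qed
  then show ?thesis by blast
qed

text \<open>Minimizing at each step cannot do worse than always taking
  \<open>tail_action\<close>.\<close>

lemma backward_le_tail: "backward \<theta> k s \<le> tail \<theta> s"
proof (induction k arbitrary: s)
  case (Suc k)
  have "envelope (r1 M * backward \<theta> k (Suc s)) \<le> envelope (r1 M * tail \<theta> (Suc s))"
    using r1 Suc by (intro envelope_mono mult_left_mono) auto
  also have "\<dots> \<le> energy tail_action + (1 - efficacy tail_action) * (r1 M * tail \<theta> (Suc s))"
    by (rule envelope_le)
  finally show ?case using tail_eq[of \<theta> s] by simp
qed simp

lemma backward_nonneg: "0 \<le> backward 0 k s"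
proof (induction k arbitrary: s)
  case (Suc k)
  then show ?case using r1 by (simp add: envelope_nonneg)
qed (simp add: tail_nonneg)

lemma continuous_on_backward: "continuous_on UNIV (\<lambda>\<theta>. backward \<theta> k s)"
proof (induction k arbitrary: s)
  case 0
  have "tail_rate \<noteq> 1" using tail_rate_less[OF nondegenerate] by simp
  then show ?case by (simp add: tail_def) (intro continuous_intros, simp)
next
  case (Suc k)
  then show ?case by (simp, intro continuous_intros continuous_on_envelope)
qed

text \<open>The value at \<open>s\<close> after \<open>k\<close> steps reads \<open>tail\<close>
  only at \<open>s + k\<close>, where one more Bellman step changes nothing.\<close>

lemma backward_Suc_eq:
  assumes "\<forall>s \<ge> S. tail \<theta> s = real s - \<theta> + envelope (r1 M * tail \<theta> (Suc s))"
    and "S \<le> s + k"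
  shows "backward \<theta> (Suc k) s = backward \<theta> k s"
  using assms(2)
proof (induction k arbitrary: s)
  case 0
  then show ?case using assms(1)[rule_format, of s] by simp
next
  case (Suc k)
  then show ?case using Suc.IH[of "Suc s"] by simp
qed

lemma backward_eq_tail:
  assumes "\<forall>s \<ge> S. tail \<theta> s = real s - \<theta> + envelope (r1 M * tail \<theta> (Suc s))"
    and "S \<le> s"
  shows "backward \<theta> k s = tail \<theta> s"
  using assms(2)
proof (induction k)
  case (Suc k)
  then show ?case using backward_Suc_eq[OF assms(1), of s k] by (simp del: backward.simps)
qed simp

lemma bellman_solution_exists: "\<exists>\<theta> V. bellman_solution M \<theta> V"
proof -
  \<comment> \<open>Large enough that \<open>F \<Theta>\<close> is nonnegative, because
    \<open>backward \<Theta> S 1\<close> is at most \<open>tail 0 1\<close>.\<close>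
  define \<Theta> where "\<Theta> = tail 0 1"
  have "0 \<le> \<Theta>" by (simp add: \<Theta>_def tail_nonneg)
  obtain S where S: "\<And>\<theta>. \<theta> \<le> \<Theta> \<Longrightarrow>
      \<forall>s \<ge> S. tail \<theta> s = real s - \<theta> + envelope (r1 M * tail \<theta> (Suc s))"
    using tail_solves by metis
  define a where "a = drift M 0"
  have a: "0 \<le> a" "a \<le> 1" unfolding a_def by (rule drift_bounds)+
  \<comment> \<open>With \<open>V 0 = 0\<close>, the Bellman equation at 0 says that
    \<open>F \<theta>\<close> vanishes.\<close>
  define F where "F \<theta> = \<theta> - envelope (a * backward \<theta> S 1)" for \<theta>
  have "F 0 \<le> 0"
    using a backward_nonneg by (simp add: F_def envelope_nonneg)
  moreover have "0 \<le> F \<Theta>"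
  proof -
    have "backward \<Theta> S 1 \<le> \<Theta>"
      using backward_le_tail[of \<Theta> S 1] tail_antimono[OF \<open>0 \<le> \<Theta>\<close>, of 1] by (simp add: \<Theta>_def)
    then have "a * backward \<Theta> S 1 \<le> a * \<Theta>" using a by (intro mult_left_mono)
    also have "\<dots> \<le> \<Theta>" using a \<open>0 \<le> \<Theta>\<close> by (simp add: mult_left_le_one_le)
    finally show ?thesis
      using envelope_le[of "a * backward \<Theta> S 1" Idle] by (simp add: F_def)
  qed
  moreover have "continuous_on {0..\<Theta>} F"
    unfolding F_def
    by (intro continuous_intros continuous_on_envelope
        continuous_on_subset[OF continuous_on_backward subset_UNIV])
  ultimately obtain \<theta> where \<theta>: "0 \<le> \<theta>" "\<theta> \<le> \<Theta>" "F \<theta> = 0"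
    using IVT'[of F 0 0 \<Theta>] \<open>0 \<le> \<Theta>\<close> by blast
  define W where "W = backward \<theta> S"
  \<comment> \<open>After \<open>S\<close> steps every state satisfies \<open>S \<le> s + S\<close>,
    so \<open>W\<close> is a fixed point.\<close>
  have W: "W s = real s - \<theta> + envelope (r1 M * W (Suc s))" for s
    using backward_Suc_eq[OF S[OF \<theta>(2)], of s S] by (simp add: W_def)
  \<comment> \<open>Replacing \<open>W 0\<close> is harmless, as the recursion for \<open>W\<close>
    at other states only looks upwards.\<close>
  define V where "V s = (if s = 0 then 0 else W s)" for s
  have eq: "\<theta> + V s = Min (action_value M V s ` {Idle, Compressed, Uncompressed})" for s
  proof (cases s)
    case 0
    then show ?thesis
      unfolding Min_action_value using \<theta>(3) by (simp add: F_def V_def W_def a_def)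
  next
    case (Suc n)
    then show ?thesis
      unfolding Min_action_value using W[of s] by (simp add: V_def drift_def)
  qed
  have ge: "\<theta> + V s \<le> action_value M V s \<delta>" for s \<delta>
    unfolding eq UNIV_action[symmetric] by (rule Min_le) auto
  have "\<exists>\<delta>. action_value M V s \<delta> = \<theta> + V s" for s
    using Min_in[of "action_value M V s ` {Idle, Compressed, Uncompressed}"] eq[of s] by auto
  then obtain f where f: "\<And>s. action_value M V s (f s) = \<theta> + V s" by metis
  have below: "bdd_below (range V)"
  proof (rule bdd_belowI2)
    fix s
    show "min (tail \<theta> 0) (Min (V ` {..S})) \<le> V s"
    proof (cases "s \<le> S")
      case True
      then show ?thesis by (intro min.coboundedI2 Min_le) auto
    next
      case False
      then have "V s = tail \<theta> s"
        using backward_eq_tail[OF S[OF \<theta>(2)], of s S] by (simp add: V_def W_def)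
      then show ?thesis using tail_ge[of s \<theta>] by (intro min.coboundedI1) simp
    qed
  qed
  have "V s \<le> tail_slope * real s + \<bar>tail \<theta> 0\<bar>" for s
  proof (cases "s = 0")
    case False
    then have "V s \<le> tail \<theta> s" using backward_le_tail by (simp add: V_def W_def)
    also have "tail \<theta> s = tail_slope * real s + tail \<theta> 0" by (simp add: tail_def)
    finally show ?thesis by linarith
  qed (simp add: V_def)
  then have "optimal_value M s0 = ereal \<theta>" for s0
    using tail_slope_ge by (intro optimal_value_eq[OF below _ _ ge f]) auto
  then show ?thesis
    using below eq unfolding bellman_solution_def by blast
qed

end

subsection \<open>Transmissions that are never decoded\<close>

text \<open>The law of the state is the same under all policies, so idling minimizes the total cost
  at every horizon. This includes \<open>r1 M = 1\<close>, where the average cost from an unstable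
  state is infinite and no real \<theta> exists.\<close>

lemma idle_optimal:
  assumes "rho M = 0"
  shows "optimal_policy M (stationary (\<lambda>_. Idle))"
proof -
  have "efficacy \<delta> = 0" for \<delta> using assms by (cases \<delta>) auto
  moreover define K where "K s = step M s Idle" for s
  ultimately have step: "step M s \<delta> = K s" for s \<delta>
    by (simp add: step_def up_prob_eq)
  have same: "expected_state M \<pi> s0 \<phi> t = expected_state M \<pi>' s0 \<phi> t" for \<pi> \<pi>' s0 \<phi> t
  proof (induction t arbitrary: \<phi>)
    case (Suc t)
    have "expected_state M \<pi> s0 \<phi> (Suc t)
        = expected_state M \<pi> s0 (\<lambda>s. measure_pmf.expectation (K s) \<phi>) t" for \<pi>
      unfolding expected_state_Suc unfolding expected_state_def by (simp add: step)
    then show ?case using Suc by simp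
  qed simp
  have "total_cost M (stationary (\<lambda>_. Idle)) s0 T \<le> total_cost M \<pi> s0 T" for \<pi> s0 T
  proof (induction T)
    case (Suc T)
    have "total_cost M (stationary (\<lambda>_. Idle)) s0 (Suc T)
        = total_cost M (stationary (\<lambda>_. Idle)) s0 T
          + expected_state M (stationary (\<lambda>_. Idle)) s0 real T"
      by (simp add: total_cost_Suc expected_state_def stationary_def)
    then show ?case
      using Suc total_cost_Suc_ge[of \<pi> s0 T] same[of "stationary (\<lambda>_. Idle)" s0 real T \<pi>]
      by simp
  qed simp
  then have "average_cost M (stationary (\<lambda>_. Idle)) s0 \<le> average_cost M \<pi> s0" for \<pi> s0
    unfolding average_cost_def
    by (intro Liminf_mono always_eventually allI) (simp add: divide_right_mono)
  then show ?thesis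
    unfolding optimal_policy_def optimal_value_def
    by (intro allI antisym INF_greatest INF_lower) auto
qed

end

theorem theorem1:
  fixes M :: aosi_system
  assumes "0 \<le> r0 M" "r0 M \<le> 1"
    and "0 \<le> r1 M" "r1 M \<le> 1"
    and "r0 M + r1 M \<ge> 1"
    and "0 \<le> rho M" "rho M \<le> 1"
    and "0 \<le> p1 M" "p1 M < p2 M" "p2 M \<le> 1"
    and "0 \<le> energy1 M" "energy1 M < energy2 M"
  shows "(\<exists>n1 n2. n1 \<le> n2 \<and> (0 < rho M \<and> 0 < r1 M \<longrightarrow> n2 < \<infinity>) \<and>
            optimal_policy M (stationary (threshold n1 n2)))
       \<and> (0 < rho M \<or> r1 M < 1 \<longrightarrow> (\<exists>\<theta> V. bellman_solution M \<theta> V))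
       \<and> (\<forall>\<theta> V. bellman_solution M \<theta> V \<longrightarrow>
            (\<exists>n1 n2. n1 \<le> n2 \<and> (0 < rho M \<and> 0 < r1 M \<longrightarrow> n2 < \<infinity>) \<and>
               (\<forall>s. is_arg_min (action_value M V s) (\<lambda>_. True) (threshold n1 n2 s)) \<and>
               optimal_policy M (stationary (threshold n1 n2))))"
proof -
  interpret aosi M by unfold_locales (fact assms)+
  have "\<exists>n1 n2. n1 \<le> n2 \<and> (0 < rho M \<and> 0 < r1 M \<longrightarrow> n2 < \<infinity>) \<and>
      optimal_policy M (stationary (threshold n1 n2))"
  \<comment> \<open>In the degenerate case, always idling is the threshold policy with both
    thresholds infinite.\<close>
  proof (cases "0 < rho M \<or> r1 M < 1")
    case True
    then show ?thesis using bellman_solution_exists bellman_solution_threshold by metis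
  next
    case False
    then have "rho M = 0" using rho by simp
    moreover have "threshold \<infinity> \<infinity> = (\<lambda>_. Idle)" by (simp add: threshold_def fun_eq_iff)
    ultimately show ?thesis using idle_optimal by (intro exI[of _ \<infinity>]) simp
  qed
  then show ?thesis using bellman_solution_exists bellman_solution_threshold by blast
qed

end
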